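(* Let $\boldsymbol{G}\in\mathbb{S}^{n+m}[\boldsymbol{x}]$ be an arrow-type polynomial matrix (see context), let $\mathcal{K}=\{\boldsymbol{x}\in\mathbb{R}^{n_x}:\boldsymbol{G}(\boldsymbol{x})\succeq0\}$ be compact, and suppose that for all $\boldsymbol{x}\in\mathcal{K}$ and $k\in[p]$, $\boldsymbol{A}_k(\boldsymbol{x})\succeq0$ and $\boldsymbol{\Gamma}(\boldsymbol{x})\succeq0$. For each $k\in[p]$, let $\boldsymbol{P}_k\in\mathbb{R}^{n\times s_k}$, $s_k\le n$, be a matrix with full column rank satisfying $\boldsymbol{P}_k^T\boldsymbol{P}_k=\boldsymbol{I}_{s_k}$ and such that $\mathrm{Span}(\boldsymbol{A}_k(\boldsymbol{x}))\subseteq\mathrm{Span}(\boldsymbol{P}_k)$ for all $\boldsymbol{x}\in\mathbb{R}^{n_x}$. Suppose moreover that $\boldsymbol{y}=(y_{\boldsymbol{\alpha}})_{\boldsymbol{\alpha}\in\mathbb{N}^{n_x}}$ has a representing measure supported on $\mathcal{K}$. Let $d\in\mathbb{N}$, $\widehat{\boldsymbol{D}}\in\mathbb{R}^{L_dn_{\mathcal{I}}\times L_dm}$, $\widehat{\boldsymbol{C}}_1,\dots,\widehat{\boldsymbol{C}}_{p-1}\in\mathbb{S}^{mL_d}$, and put $\widehat{\boldsymbol{C}}_p=\widehat{\boldsymbol{\Gamma}}(\boldsymbol{y})-\sum_{k=1}^{p-1}\widehat{\boldsymbol{C}}_k$ and $\widehat{\boldsymbol{P}}_k=\boldsymbol{P}_k\otimes\boldsymbol{I}_{L_d}$.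 Then the condition $$\begin{bmatrix}\widehat{\boldsymbol{A}}_k(\boldsymbol{y})&\widehat{\boldsymbol{B}}_k(\boldsymbol{y})+(\boldsymbol{\Pi}_k\otimes\boldsymbol{I}_{L_d})\widehat{\boldsymbol{D}}\\(\widehat{\boldsymbol{B}}_k(\boldsymbol{y})+(\boldsymbol{\Pi}_k\otimes\boldsymbol{I}_{L_d})\widehat{\boldsymbol{D}})^T&\widehat{\boldsymbol{C}}_k\end{bmatrix}\succeq0\quad\text{for all }k\in[p]$$ is equivalent to the conditions $$\begin{bmatrix}\widehat{\boldsymbol{P}}_k^T\widehat{\boldsymbol{A}}_k(\boldsymbol{y})\widehat{\boldsymbol{P}}_k&\widehat{\boldsymbol{P}}_k^T(\widehat{\boldsymbol{B}}_k(\boldsymbol{y})+(\boldsymbol{\Pi}_k\otimes\boldsymbol{I}_{L_d})\widehat{\boldsymbol{D}})\\(\widehat{\boldsymbol{B}}_k(\boldsymbol{y})+(\boldsymbol{\Pi}_k\otimes\boldsymbol{I}_{L_d})\widehat{\boldsymbol{D}})^T\widehat{\boldsymbol{P}}_k&\widehat{\boldsymbol{C}}_k\end{bmatrix}\succeq0\quad\text{for all }k\in[p],$$ $$\mathrm{Span}(\widehat{\boldsymbol{B}}_k(\boldsymbol{y})+(\boldsymbol{\Pi}_k\otimes\boldsymbol{I}_{L_d})\widehat{\boldsymbol{D}})\subseteq\mathrm{Span}(\widehat{\boldsymbol{P}}_k)\quad\text{for all }k\in[p].$$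
   Context: $[p]=\{1,\dots,p\}$; $\mathbb{S}^n$ denotes real symmetric $n\times n$ matrices and $\mathbb{S}^n[\boldsymbol{x}]$, $\mathbb{R}^{n\times m}[\boldsymbol{x}]$ the symmetric, resp. rectangular, matrices with entries polynomial in $\boldsymbol{x}\in\mathbb{R}^{n_x}$. $\mathrm{Span}(\boldsymbol{M})$ is the column space of $\boldsymbol{M}$; $\otimes$ is the Kronecker product. $\boldsymbol{y}$ has a representing measure supported on $\mathcal{K}$ if there is a finite (nonnegative) Borel measure $\mu$ supported on $\mathcal{K}$ with $y_{\boldsymbol{\alpha}}=\int_{\mathcal{K}}\boldsymbol{x}^{\boldsymbol{\alpha}}d\mu$ for all $\boldsymbol{\alpha}$. $\mathscr{L}_{\boldsymbol{y}}$ is the linear map $\sum_{\boldsymbol{\alpha}}q_{\boldsymbol{\alpha}}\boldsymbol{x}^{\boldsymbol{\alpha}}\mapsto\sum_{\boldsymbol{\alpha}}q_{\boldsymbol{\alpha}}y_{\boldsymbol{\alpha}}$, applied entrywise to polynomial matrices. $\boldsymbol{b}_d(\boldsymbol{x})$ is the row vector of all monomials of degree at most $d$, $L_d$ its length. Arrow-type polynomial matrix: $\boldsymbol{G}(\boldsymbol{x})=\sum_{k=1}^p\begin{bmatrix}\boldsymbol{A}_k(\boldsymbol{x})&\boldsymbol{B}_k(\boldsymbol{x})\\\boldsymbol{B}_k(\boldsymbol{x})^T&\boldsymbol{0}\end{bmatrix}+\begin{bmatrix}\boldsymbol{0}&\boldsymbol{0}\\\boldsymbol{0}&\boldsymbol{\Gamma}(\boldsymbol{x})\end{bmatrix}$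 with $\boldsymbol{A}_k\in\mathbb{S}^n[\boldsymbol{x}]$, $\boldsymbol{B}_k\in\mathbb{R}^{n\times m}[\boldsymbol{x}]$, $\boldsymbol{\Gamma}\in\mathbb{S}^m[\boldsymbol{x}]$. Here $\mathcal{I}_k\subseteq[n]$ is the set of indices of the rows/columns of $\boldsymbol{A}_k$ that are not identically zero; these sets may overlap, $\bigcup_k\mathcal{I}_k=[n]$, and rows of $\boldsymbol{B}_k$ with index outside $\mathcal{I}_k$ are zero. For $k<\ell$, $\mathcal{I}_{k,\ell}=\mathcal{I}_k\cap\mathcal{I}_\ell$, and $n_{\mathcal{I}}=\sum_{k<\ell}|\mathcal{I}_{k,\ell}|$. $\widehat{\boldsymbol{A}}_k(\boldsymbol{y})=\mathscr{L}_{\boldsymbol{y}}(\boldsymbol{A}_k(\boldsymbol{x})\otimes\boldsymbol{b}_d(\boldsymbol{x})^T\boldsymbol{b}_d(\boldsymbol{x}))$, $\widehat{\boldsymbol{B}}_k(\boldsymbol{y})=\mathscr{L}_{\boldsymbol{y}}(\boldsymbol{B}_k(\boldsymbol{x})\otimes\boldsymbol{b}_d(\boldsymbol{x})^T\boldsymbol{b}_d(\boldsymbol{x}))$, $\widehat{\boldsymbol{\Gamma}}(\boldsymbol{y})=\mathscr{L}_{\boldsymbol{y}}(\boldsymbol{\Gamma}(\boldsymbol{x})\otimes\boldsymbol{b}_d(\boldsymbol{x})^T\boldsymbol{b}_d(\boldsymbol{x}))$. Matrices $\boldsymbol{\Pi}_k$: write $\boldsymbol{D}\in\mathbb{R}^{n_{\mathcal{I}}\times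 m}$ as a vertical concatenation (in a fixed order of the pairs $k<\ell$) of blocks $\overline{\boldsymbol{D}}_{k,\ell}\in\mathbb{R}^{|\mathcal{I}_{k,\ell}|\times m}$, and let $\boldsymbol{D}_{k,\ell}\in\mathbb{R}^{n\times m}$ be the matrix whose rows indexed by $\mathcal{I}_{k,\ell}$ (in increasing order) are those of $\overline{\boldsymbol{D}}_{k,\ell}$ and whose other rows are zero. Then $\boldsymbol{\Pi}_k\in\mathbb{R}^{n\times n_{\mathcal{I}}}$ is the matrix with entries in $\{0,1,-1\}$ such that $\boldsymbol{\Pi}_k\boldsymbol{D}=-\sum_{\ell<k}\boldsymbol{D}_{\ell,k}+\sum_{\ell>k}\boldsymbol{D}_{k,\ell}$ for every $\boldsymbol{D}$. *)

theory Defs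
  imports
    "HOL-Analysis.Analysis"
    "HOL-Library.Poly_Mapping"
    "Jordan_Normal_Form.Matrix"
    "Jordan_Normal_Form.DL_Rank"
begin

text \<open>
  The symbol \<open>$\<close> and the type name \<open>vec\<close> belong both to HOL-Analysis and to Jordan_Normal_Form.
  Points and exponents are of type \<open>real ^ 'v\<close> and \<open>nat ^ 'v\<close> (the variables are
  indexed by \<open>'v\<close>); all matrices are those of Jordan_Normal_Form, hence their rows and columns are
  numbered from 0.
\<close>

unbundle no vec_syntax

type_synonym 'v mpoly = "(nat ^ 'v) \<Rightarrow>\<^sub>0 real"


section \<open>Matrices\<close>

definition psd :: "real mat \<Rightarrow> bool" where
  "psd M \<longleftrightarrow> square_mat M \<and> transpose_mat M = M \<and>
     (\<forall>v \<in> carrier_vec (dim_row M). 0 \<le> scalar_prod v (M *\<^sub>v v))"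

definition kron :: "'a::times mat \<Rightarrow> 'a mat \<Rightarrow> 'a mat" where
  "kron M N = mat (dim_row M * dim_row N) (dim_col M * dim_col N)
     (\<lambda>(i, j). M $$ (i div dim_row N, j div dim_col N) * N $$ (i mod dim_row N, j mod dim_col N))"

text \<open>Matrices of varying size are no monoid, so \<open>sum\<close> does not apply to them.\<close>

definition msum :: "nat \<Rightarrow> nat \<Rightarrow> ('i \<Rightarrow> 'a::comm_monoid_add mat) \<Rightarrow> 'i set \<Rightarrow> 'a mat" where
  "msum nr nc F S = mat nr nc (\<lambda>ij. \<Sum>k\<in>S. F k $$ ij)"

definition Span :: "real mat \<Rightarrow> real Matrix.vec set" where
  "Span M = vec_space.col_space (dim_row M) M"


section \<open>Polynomials, moments and localizing matrices\<close>

definition monomial_at :: "real ^ 'v \<Rightarrow> nat ^ 'v \<Rightarrow> real" where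
  "monomial_at x \<alpha> = (\<Prod>i\<in>UNIV. vec_nth x i ^ vec_nth \<alpha> i)"

definition riesz :: "(nat ^ 'v \<Rightarrow> real) \<Rightarrow> 'v mpoly \<Rightarrow> real" where
  "riesz y q = (\<Sum>\<alpha>\<in>Poly_Mapping.keys q. Poly_Mapping.lookup q \<alpha> * y \<alpha>)"

definition eval_at :: "real ^ 'v \<Rightarrow> 'v mpoly \<Rightarrow> real" where
  "eval_at x q = (\<Sum>\<alpha>\<in>Poly_Mapping.keys q. Poly_Mapping.lookup q \<alpha> * monomial_at x \<alpha>)"

definition has_representing_measure :: "(nat ^ 'v \<Rightarrow> real) \<Rightarrow> (real ^ 'v) set \<Rightarrow> bool" where
  "has_representing_measure y K \<longleftrightarrow>
     (\<exists>\<mu> :: (real ^ 'v) measure. sets \<mu> = sets borel \<and> finite_measure \<mu> \<and> (AE x in \<mu>. x \<in> K) \<and>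
        (\<forall>\<alpha>. set_integrable \<mu> K (\<lambda>x. monomial_at x \<alpha>) \<and>
             y \<alpha> = (LINT x:K|\<mu>. monomial_at x \<alpha>)))"

text \<open>The order of the monomials in the row \<open>b\<^sub>d\<close> is arbitrary but fixed; \<open>L\<^sub>d\<close> is \<open>length ms\<close>.\<close>

definition enumerates_monomials :: "nat \<Rightarrow> (nat ^ 'v) list \<Rightarrow> bool" where
  "enumerates_monomials d ms \<longleftrightarrow> distinct ms \<and> set ms = {\<alpha>. (\<Sum>i\<in>UNIV. vec_nth \<alpha> i) \<le> d}"

definition monomial_row :: "(nat ^ 'v) list \<Rightarrow> 'v mpoly mat" where
  "monomial_row ms = mat 1 (length ms) (\<lambda>(i, j). Poly_Mapping.single (ms ! j) 1)"

definition localizing ::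
    "(nat ^ 'v) list \<Rightarrow> (nat ^ 'v \<Rightarrow> real) \<Rightarrow> 'v mpoly mat \<Rightarrow> real mat" where
  "localizing ms y M =
     map_mat (riesz y) (kron M (transpose_mat (monomial_row ms) * monomial_row ms))"


section \<open>Arrow-type polynomial matrices\<close>

text \<open>For symmetric matrices nonzero rows and nonzero columns have the same indices.\<close>

definition row_support :: "'a::zero mat \<Rightarrow> nat set" where
  "row_support M = {i. i < dim_row M \<and> (\<exists>j < dim_col M. M $$ (i, j) \<noteq> 0)}"

definition arrow_data ::
    "nat \<Rightarrow> nat \<Rightarrow> nat \<Rightarrow> (nat \<Rightarrow> 'v mpoly mat) \<Rightarrow> (nat \<Rightarrow> 'v mpoly mat) \<Rightarrow> 'v mpoly mat \<Rightarrow> bool" where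
  "arrow_data p n m A B \<Gamma> \<longleftrightarrow>
     (\<forall>k\<in>{1..p}.
        A k \<in> carrier_mat n n \<and> transpose_mat (A k) = A k \<and>
        B k \<in> carrier_mat n m \<and> row_support (B k) \<subseteq> row_support (A k)) \<and>
     (\<Union>k\<in>{1..p}. row_support (A k)) = {0..<n} \<and>
     \<Gamma> \<in> carrier_mat m m \<and> transpose_mat \<Gamma> = \<Gamma>"

definition arrow_matrix ::
    "nat \<Rightarrow> nat \<Rightarrow> nat \<Rightarrow> (nat \<Rightarrow> 'v mpoly mat) \<Rightarrow> (nat \<Rightarrow> 'v mpoly mat) \<Rightarrow> 'v mpoly mat
      \<Rightarrow> 'v mpoly mat" where
  "arrow_matrix p n m A B \<Gamma> =
     msum (n + m) (n + m)
       (\<lambda>k. four_block_mat (A k) (B k) (transpose_mat (B k)) (0\<^sub>m m m)) {1..p} +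
     four_block_mat (0\<^sub>m n n) (0\<^sub>m n m) (0\<^sub>m m n) \<Gamma>"


section \<open>Overlaps\<close>

definition pairs :: "nat \<Rightarrow> (nat \<times> nat) set" where
  "pairs p = {(k, l). 1 \<le> k \<and> k < l \<and> l \<le> p}"

definition overlap_total :: "nat \<Rightarrow> (nat \<Rightarrow> nat set) \<Rightarrow> nat" where
  "overlap_total p I = (\<Sum>(k, l)\<in>pairs p. card (I k \<inter> I l))"

definition stack :: "nat \<Rightarrow> 'a::zero mat list \<Rightarrow> 'a mat" where
  "stack m Ms = foldr append_rows Ms (0\<^sub>m 0 m)"

text \<open>Row \<open>i \<in> J\<close> is the row of \<open>M\<close> whose number is the rank of \<open>i\<close> in \<open>J\<close>; the others are zero.\<close>

definition spread_rows :: "nat \<Rightarrow> nat \<Rightarrow> nat set \<Rightarrow> 'a::zero mat \<Rightarrow> 'a mat" where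
  "spread_rows n m J M = mat n m (\<lambda>(i, j). if i \<in> J then M $$ (card {i'\<in>J. i' < i}, j) else 0)"

text \<open>
  \<open>ps\<close> is the fixed order of the pairs. Every \<open>D\<close> with \<open>overlap_total p I\<close> rows and \<open>m\<close> columns
  is \<open>stack\<close> of a unique family of blocks, so the quantifier over the blocks \<open>E\<close> is one over \<open>D\<close>.
\<close>

definition is_overlap_matrix ::
    "nat \<Rightarrow> nat \<Rightarrow> nat \<Rightarrow> (nat \<Rightarrow> nat set) \<Rightarrow> (nat \<times> nat) list \<Rightarrow> nat \<Rightarrow> real mat \<Rightarrow> bool" where
  "is_overlap_matrix p n m I ps k Pk \<longleftrightarrow>
     Pk \<in> carrier_mat n (overlap_total p I) \<and> elements_mat Pk \<subseteq> {0, 1, -1} \<and>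
     (\<forall>E :: nat \<Rightarrow> nat \<Rightarrow> real mat.
        (\<forall>(a, b)\<in>pairs p. E a b \<in> carrier_mat (card (I a \<inter> I b)) m) \<longrightarrow>
        Pk * stack m (map (\<lambda>(a, b). E a b) ps) =
          - msum n m (\<lambda>l. spread_rows n m (I l \<inter> I k) (E l k)) {1..<k} +
          msum n m (\<lambda>l. spread_rows n m (I k \<inter> I l) (E k l)) {k<..p})"

end

theory Submission
  imports Defs
begin

text \<open>
  Put \<open>Q = Phat k * transpose_mat (Phat k)\<close>; since \<open>Phat k\<close> has orthonormal columns, this is the
  orthogonal projection onto its column space, so that \<open>Span M \<subseteq> Span (Phat k)\<close> says \<open>Q * M = M\<close>
  (\<open>Span_subset_iff_projection\<close>). Two observations prove the equivalence, one index \<open>k\<close> at a time.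

  The first is that \<open>Q\<close> fixes \<open>Ahat k\<close>. For every point \<open>x\<close> the projection
  \<open>P k * transpose_mat (P k)\<close> fixes the value \<open>A k (x)\<close>, hence its Kronecker product with the identity
  fixes \<open>A k (x) \<otimes> b(x)\<^sup>T b(x)\<close>. The representing measure turns the Riesz functional into an
  integral, so \<open>Ahat k\<close> is the entrywise integral of these matrices, and a linear relation with
  constant coefficients that holds at every point survives integration
  (\<open>riesz_mult_invariant\<close>, \<open>localizing_mult_invariant\<close>).

  The second is pure linear algebra (\<open>psd_block_compression\<close>). Let \<open>A\<close> be symmetric with \<open>Q A = A\<close>,
  hence also \<open>A Q = A\<close>. If the block matrix of \<open>A, B, C\<close> is positive semidefinite, then so
  is its compression by \<open>diag(P, 1)\<close>, which is the reduced block matrix. Moreover, a vector that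
  \<open>A\<close> annihilates makes the quadratic form of the block matrix vanish, and therefore lies in the
  kernel of the block matrix and so of \<open>B\<^sup>T\<close> (\<open>psd_block_kernel\<close>). Applied to the range of
  \<open>1 - Q\<close> this gives \<open>B\<^sup>T (1 - Q) = 0\<close>, which is the inclusion of the column spaces.
  Conversely, if \<open>Q A = A\<close> and \<open>Q B = B\<close>, then expanding the reduced block matrix by
  \<open>diag(P, 1)\<close> gives back the original one, which is positive semidefinite as a congruence of a
  positive semidefinite matrix.
\<close>

section \<open>Positive semidefinite matrices\<close>

lemma psd_congruence:
  assumes "psd M" and M: "M \<in> carrier_mat n n" and R: "R \<in> carrier_mat n r"
  shows "psd (transpose_mat R * M * R)"
  unfolding psd_def
proof (intro conjI ballI)
  have sym: "transpose_mat M = M"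
    using assms(1) unfolding psd_def by simp
  have RM: "transpose_mat R * M \<in> carrier_mat r n"
    using M R by simp
  show "square_mat (transpose_mat R * M * R)"
    using R by simp
  have "transpose_mat (transpose_mat R * M * R) = transpose_mat R * (M * R)"
    using transpose_mult[OF RM R] transpose_mult[of "transpose_mat R" r n M n] M R sym by simp
  also have "\<dots> = transpose_mat R * M * R"
    using M R by simp
  finally show "transpose_mat (transpose_mat R * M * R) = transpose_mat R * M * R" .
  fix v :: "real Matrix.vec" assume "v \<in> carrier_vec (dim_row (transpose_mat R * M * R))"
  then have v: "v \<in> carrier_vec r"
    using R by simp
  have Rv: "R *\<^sub>v v \<in> carrier_vec n"
    using R v by simp
  have "(transpose_mat R * M * R) *\<^sub>v v = transpose_mat R *\<^sub>v (M *\<^sub>v (R *\<^sub>v v))"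
    using M R v Rv assoc_mult_mat_vec[OF RM R v] by (simp add: assoc_mult_mat_vec)
  then have "scalar_prod v ((transpose_mat R * M * R) *\<^sub>v v)
      = scalar_prod (transpose_mat R *\<^sub>v (M *\<^sub>v (R *\<^sub>v v))) v"
    using M R v Rv by (simp add: comm_scalar_prod[of _ r])
  also have "\<dots> = scalar_prod (M *\<^sub>v (R *\<^sub>v v)) (R *\<^sub>v v)"
    using M R v Rv by (intro transpose_vec_mult_scalar) auto
  also have "\<dots> = scalar_prod (R *\<^sub>v v) (M *\<^sub>v (R *\<^sub>v v))"
    using M Rv by (intro comm_scalar_prod) auto
  also have "\<dots> \<ge> 0"
    using assms(1) M Rv unfolding psd_def by auto
  finally show "0 \<le> scalar_prod v ((transpose_mat R * M * R) *\<^sub>v v)" .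
qed

lemma vec_conjugate_real: "conjugate (v :: real Matrix.vec) = v"
  by (intro eq_vecI) auto

text \<open>
  If \<open>w = M v\<close> were not zero, the quadratic form at \<open>w + t v\<close> would be an affine function of \<open>t\<close>
  of slope \<open>2 |w|\<^sup>2 > 0\<close>, because its coefficient of \<open>t\<^sup>2\<close> is the vanishing value at \<open>v\<close>; such a
  function takes negative values.
\<close>

lemma psd_isotropic_imp_kernel:
  assumes "psd M" and M: "M \<in> carrier_mat n n" and v: "v \<in> carrier_vec n"
    and null: "scalar_prod v (M *\<^sub>v v) = 0"
  shows "M *\<^sub>v v = 0\<^sub>v n"
proof (rule ccontr)
  define w where "w = M *\<^sub>v v"
  have w: "w \<in> carrier_vec n"
    using M v by (simp add: w_def)
  assume "M *\<^sub>v v \<noteq> 0\<^sub>v n"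
  then have pos: "0 < scalar_prod w w"
    using w conjugate_square_greater_0_vec[OF w] by (simp add: w_def vec_conjugate_real)
  \<comment> \<open>the parameter at which the affine function takes the value \<open>-1\<close>\<close>
  define t where "t = - (scalar_prod w (M *\<^sub>v w) + 1) / (2 * scalar_prod w w)"
  have Mw: "M *\<^sub>v w \<in> carrier_vec n"
    using M w by simp
  have "scalar_prod v (M *\<^sub>v w) = scalar_prod (transpose_mat M *\<^sub>v v) w"
    using M v w by (intro transpose_vec_mult_scalar[symmetric]) auto
  then have vMw: "scalar_prod v (M *\<^sub>v w) = scalar_prod w w"
    using assms(1) unfolding psd_def w_def by simp
  have "M *\<^sub>v (w + t \<cdot>\<^sub>v v) = M *\<^sub>v w + t \<cdot>\<^sub>v w"
    using M v w by (simp add: mult_add_distrib_mat_vec[OF M] mult_mat_vec[OF M] w_def)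
  then have "scalar_prod (w + t \<cdot>\<^sub>v v) (M *\<^sub>v (w + t \<cdot>\<^sub>v v))
      = scalar_prod w (M *\<^sub>v w) + 2 * t * scalar_prod w w + t * t * scalar_prod v w"
    using v w Mw vMw
    by (simp add: scalar_prod_add_distrib[of _ n] add_scalar_prod_distrib[of _ n] algebra_simps)
  moreover have "0 \<le> scalar_prod (w + t \<cdot>\<^sub>v v) (M *\<^sub>v (w + t \<cdot>\<^sub>v v))"
    using assms(1) M v w unfolding psd_def by auto
  ultimately have "0 \<le> scalar_prod w (M *\<^sub>v w) + 2 * t * scalar_prod w w"
    using null by (simp add: w_def)
  then show False
    using pos by (simp add: t_def field_simps)
qed

text \<open>
  The vector \<open>(v, 0)\<close> is isotropic for the block matrix, hence in its kernel; the lower component of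
  the product is \<open>B\<^sup>T v\<close>.
\<close>

lemma psd_block_kernel:
  assumes psd: "psd (four_block_mat A B (transpose_mat B) C)"
    and A: "A \<in> carrier_mat n n" and B: "B \<in> carrier_mat n m" and C: "C \<in> carrier_mat m m"
    and v: "v \<in> carrier_vec n" and Av: "A *\<^sub>v v = 0\<^sub>v n"
  shows "transpose_mat B *\<^sub>v v = 0\<^sub>v m"
proof -
  let ?M = "four_block_mat A B (transpose_mat B) C" and ?u = "v @\<^sub>v 0\<^sub>v m"
  have Bv: "transpose_mat B *\<^sub>v v \<in> carrier_vec m"
    using B v by simp
  have "?M *\<^sub>v ?u = (A *\<^sub>v v + B *\<^sub>v 0\<^sub>v m) @\<^sub>v (transpose_mat B *\<^sub>v v + C *\<^sub>v 0\<^sub>v m)"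
    using A B C v by (intro four_block_mat_mult_vec) auto
  also have "B *\<^sub>v 0\<^sub>v m = 0\<^sub>v n"
    using B by auto
  also have "C *\<^sub>v 0\<^sub>v m = 0\<^sub>v m"
    using C by auto
  finally have Mu: "?M *\<^sub>v ?u = 0\<^sub>v n @\<^sub>v (transpose_mat B *\<^sub>v v)"
    using Av Bv by simp
  have "scalar_prod ?u (?M *\<^sub>v ?u) = 0"
    unfolding Mu using v Bv by (subst scalar_prod_append) auto
  then have "?M *\<^sub>v ?u = 0\<^sub>v (n + m)"
    using A C v by (intro psd_isotropic_imp_kernel[OF psd]) auto
  then have "0\<^sub>v n @\<^sub>v (transpose_mat B *\<^sub>v v) = 0\<^sub>v n @\<^sub>v 0\<^sub>v m"
    unfolding Mu by (auto intro: eq_vecI)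
  then show ?thesis
    by (simp add: append_vec_eq[of _ n])
qed

section \<open>Column spaces and orthonormal columns\<close>

lemma mat_eq_if_mult_vec_eq:
  fixes A B :: "'a::semiring_1 mat"
  assumes A: "A \<in> carrier_mat n m" and B: "B \<in> carrier_mat n m"
    and eq: "\<And>v. v \<in> carrier_vec m \<Longrightarrow> A *\<^sub>v v = B *\<^sub>v v"
  shows "A = B"
proof (rule eq_matI)
  fix i j assume "i < dim_row B" "j < dim_col B"
  then have "i < n" "j < m" using B by auto
  moreover from this have "(A *\<^sub>v unit_vec m j) $ i = (B *\<^sub>v unit_vec m j) $ i"
    by (simp add: eq)
  ultimately show "A $$ (i, j) = B $$ (i, j)"
    using A B by simp
qed (use A B in auto)

lemma Span_eq: "Span M = {M *\<^sub>v v | v. v \<in> carrier_vec (dim_col M)}"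
proof -
  have "M \<in> carrier_mat (dim_row M) (dim_col M)" by simp
  from vec_space.col_space_eq[OF this] show ?thesis
    unfolding Span_def by (auto intro!: mult_mat_vec_carrier)
qed

lemma Span_subset_iff_projection:
  assumes M: "M \<in> carrier_mat n m" and P: "P \<in> carrier_mat n r"
    and orth: "transpose_mat P * P = 1\<^sub>m r"
  shows "Span M \<subseteq> Span P \<longleftrightarrow> P * transpose_mat P * M = M"
proof
  have Pt: "transpose_mat P \<in> carrier_mat r n" and PPt: "P * transpose_mat P \<in> carrier_mat n n"
    using P by auto
  have fixed: "P * transpose_mat P * P = P"
    using P orth by simp
  assume sub: "Span M \<subseteq> Span P"
  show "P * transpose_mat P * M = M"
  proof (rule mat_eq_if_mult_vec_eq)
    fix v :: "real Matrix.vec" assume v: "v \<in> carrier_vec m"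
    then have "M *\<^sub>v v \<in> Span P"
      using sub M by (auto simp: Span_eq)
    then obtain w where w: "w \<in> carrier_vec r" "M *\<^sub>v v = P *\<^sub>v w"
      using P by (auto simp: Span_eq)
    have "(P * transpose_mat P * M) *\<^sub>v v = (P * transpose_mat P) *\<^sub>v (P *\<^sub>v w)"
      using assoc_mult_mat_vec[OF PPt M v] w by simp
    also have "\<dots> = M *\<^sub>v v"
      using assoc_mult_mat_vec[OF PPt P w(1)] fixed w by simp
    finally show "(P * transpose_mat P * M) *\<^sub>v v = M *\<^sub>v v" .
  qed (use P M in auto)
next
  assume eq: "P * transpose_mat P * M = M"
  show "Span M \<subseteq> Span P"
  proof
    fix u assume "u \<in> Span M"
    then obtain v where v: "v \<in> carrier_vec m" "u = M *\<^sub>v v"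
      using M by (auto simp: Span_eq)
    have "M = P * (transpose_mat P * M)"
      using eq P M by simp
    then have "u = (P * (transpose_mat P * M)) *\<^sub>v v"
      using v by simp
    also have "\<dots> = P *\<^sub>v ((transpose_mat P * M) *\<^sub>v v)"
      using P M v by (intro assoc_mult_mat_vec) auto
    finally show "u \<in> Span P"
      using P M v by (auto simp: Span_eq)
  qed
qed

text \<open>
  \<open>A\<close> annihilates the range of \<open>1 - Q\<close>, hence so does \<open>B\<^sup>T\<close>, and \<open>B\<^sup>T Q = B\<^sup>T\<close>.
\<close>

lemma psd_block_range:
  assumes psd: "psd (four_block_mat A B (transpose_mat B) C)"
    and A: "A \<in> carrier_mat n n" and B: "B \<in> carrier_mat n m" and C: "C \<in> carrier_mat m m"
    and Q: "Q \<in> carrier_mat n n" and AQ: "A * Q = A"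
  shows "transpose_mat Q * B = B"
proof -
  have Q': "1\<^sub>m n - Q \<in> carrier_mat n n"
    using Q by (rule minus_carrier_mat)
  have AQ': "A * (1\<^sub>m n - Q) = 0\<^sub>m n n"
    using A Q AQ mult_minus_distrib_mat[OF A one_carrier_mat Q] by simp
  have "transpose_mat B * (1\<^sub>m n - Q) = 0\<^sub>m m n"
  proof (rule mat_eq_if_mult_vec_eq)
    fix v :: "real Matrix.vec" assume v: "v \<in> carrier_vec n"
    have "A *\<^sub>v ((1\<^sub>m n - Q) *\<^sub>v v) = (A * (1\<^sub>m n - Q)) *\<^sub>v v"
      by (rule assoc_mult_mat_vec[OF A Q' v, symmetric])
    also have "\<dots> = 0\<^sub>v n"
      unfolding AQ' using v by auto
    finally have "transpose_mat B *\<^sub>v ((1\<^sub>m n - Q) *\<^sub>v v) = 0\<^sub>v m"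
      using Q' v by (intro psd_block_kernel[OF psd A B C]) auto
    then show "(transpose_mat B * (1\<^sub>m n - Q)) *\<^sub>v v = 0\<^sub>m m n *\<^sub>v v"
      using B v by (subst assoc_mult_mat_vec[OF _ Q' v]) auto
  qed (use B Q' in auto)
  then have "transpose_mat B - transpose_mat B * Q = 0\<^sub>m m n"
    using B Q mult_minus_distrib_mat[of "transpose_mat B" m n "1\<^sub>m n" n Q] by simp
  then have "transpose_mat B * Q = transpose_mat B"
    using B Q by (auto simp: mat_eq_iff)
  then have "transpose_mat (transpose_mat B * Q) = B"
    by simp
  then show ?thesis
    using B Q by (subst (asm) transpose_mult[of _ m n _ n]) auto
qed

text \<open>
  With \<open>R = diag(P, 1)\<close>, the reduced block matrix \<open>N\<close> is \<open>R\<^sup>T M R\<close>, while \<open>R N R\<^sup>T\<close> is the block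
  matrix of \<open>Q A Q\<close>, \<open>Q B\<close> and \<open>C\<close>. The latter is \<open>M\<close> itself precisely when \<open>Q B = B\<close>, which is the
  condition on the column spaces, and which semidefiniteness of \<open>M\<close> enforces.
\<close>

lemma psd_block_compression:
  assumes A: "A \<in> carrier_mat n n" and A_sym: "transpose_mat A = A"
    and B: "B \<in> carrier_mat n m" and C: "C \<in> carrier_mat m m"
    and P: "P \<in> carrier_mat n r" and orth: "transpose_mat P * P = 1\<^sub>m r"
    and range: "P * transpose_mat P * A = A"
  shows "psd (four_block_mat A B (transpose_mat B) C) \<longleftrightarrow>
     psd (four_block_mat (transpose_mat P * A * P) (transpose_mat P * B) (transpose_mat B * P) C) \<and>
     Span B \<subseteq> Span P"
    (is "psd ?M \<longleftrightarrow> psd ?N \<and> _")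
proof -
  define Q where "Q = P * transpose_mat P"
  have Q: "Q \<in> carrier_mat n n"
    using P by (simp add: Q_def)
  have Q_sym: "transpose_mat Q = Q"
    using P by (simp add: Q_def transpose_mult[of P n r _ n])
  have AQ: "A * Q = A"
    using transpose_mult[OF Q A] range A_sym Q_sym by (simp add: Q_def)
  define R where "R = four_block_mat P (0\<^sub>m n m) (0\<^sub>m m r) (1\<^sub>m m)"
  have R: "R \<in> carrier_mat (n + m) (r + m)"
    using P by (simp add: R_def)
  have Rt: "transpose_mat R = four_block_mat (transpose_mat P) (0\<^sub>m r m) (0\<^sub>m m n) (1\<^sub>m m)"
    using P unfolding R_def by (subst transpose_four_block_mat[of _ n r _ m _ m]) auto
  have M: "?M \<in> carrier_mat (n + m) (n + m)"
    using A C by simp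
  have N: "?N \<in> carrier_mat (r + m) (r + m)"
    using P C by (intro four_block_carrier_mat) auto
  have RMR: "transpose_mat R * ?M * R = ?N"
  proof -
    have "transpose_mat R * ?M
        = four_block_mat (transpose_mat P * A) (transpose_mat P * B) (transpose_mat B) C"
      unfolding Rt using A B C P
      by (subst mult_four_block_mat[of _ r n _ m _ m _ _ n _ m]) auto
    also have "\<dots> * R = ?N"
      unfolding R_def using A B C P
      by (subst mult_four_block_mat[of _ r n _ m _ m _ _ r _ m]) auto
    finally show ?thesis .
  qed
  have RNR: "R * ?N * transpose_mat R = ?M" if QB: "Q * B = B"
  proof -
    have PB: "P * (transpose_mat P * B) = B"
      using QB P B by (simp add: Q_def)
    have PA: "P * (transpose_mat P * A * P) = A * P"
    proof -
      have "P * (transpose_mat P * A * P) = (P * transpose_mat P * A) * P"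
        using P A by (simp add: assoc_mult_mat[of _ n r _ n _ r] assoc_mult_mat[of _ n r _ n _ n])
      then show ?thesis using range by simp
    qed
    have BP: "transpose_mat B * P * transpose_mat P = transpose_mat B"
    proof -
      have "transpose_mat (Q * B) = transpose_mat B * Q"
        using Q B Q_sym by (simp add: transpose_mult[of Q n n B m])
      then show ?thesis
        using QB P B by (simp add: Q_def)
    qed
    have AP: "A * P * transpose_mat P = A"
      using AQ A P by (simp add: Q_def)
    have "R * ?N = four_block_mat (A * P) B (transpose_mat B * P) C"
      unfolding R_def using A B C P PA PB
      by (subst mult_four_block_mat[of _ n r _ m _ m _ _ r _ m]) auto
    also have "\<dots> * transpose_mat R = ?M"
      unfolding Rt using A B C P AP BP
      by (subst mult_four_block_mat[of _ n r _ m _ m _ _ n _ m]) auto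
    finally show ?thesis .
  qed
  have span_iff: "Span B \<subseteq> Span P \<longleftrightarrow> Q * B = B"
    unfolding Q_def by (rule Span_subset_iff_projection[OF B P orth])
  show ?thesis
  proof
    assume psd: "psd ?M"
    have "psd ?N"
      using psd_congruence[OF psd M R] unfolding RMR .
    moreover have "Q * B = B"
      using psd_block_range[OF psd A B C Q AQ] Q_sym by simp
    ultimately show "psd ?N \<and> Span B \<subseteq> Span P"
      using span_iff by simp
  next
    assume asm: "psd ?N \<and> Span B \<subseteq> Span P"
    then have QB: "Q * B = B"
      using span_iff by simp
    have "psd (transpose_mat (transpose_mat R) * ?N * transpose_mat R)"
      using asm N R by (intro psd_congruence) auto
    then show "psd ?M"
      using RNR[OF QB] by simp
  qed
qed

section \<open>Kronecker products\<close>

lemma kron_carrier: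
  "M \<in> carrier_mat a b \<Longrightarrow> N \<in> carrier_mat c d \<Longrightarrow> kron M N \<in> carrier_mat (a * c) (b * d)"
  by (simp add: kron_def)

lemma div_mod_less_product:
  fixes i :: nat
  assumes "i < a * b"
  shows "i div b < a" "i mod b < b"
proof -
  have "0 < b" using assms by (cases b) auto
  then show "i div b < a" "i mod b < b"
    using assms by (simp_all add: less_mult_imp_div_less)
qed

lemma sum_div_mod:
  fixes g :: "nat \<Rightarrow> nat \<Rightarrow> 'a::comm_monoid_add"
  shows "(\<Sum>k\<in>{0..<b * e}. g (k div e) (k mod e)) = (\<Sum>u\<in>{0..<b}. \<Sum>v\<in>{0..<e}. g u v)"
proof -
  have lt: "u * e + v < b * e" if "u < b" "v < e" for u v
  proof -
    have "u * e + v < Suc u * e" using that by simp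
    also have "\<dots> \<le> b * e" using that by (intro mult_le_mono1) simp
    finally show ?thesis .
  qed
  have "(\<Sum>k\<in>{0..<b * e}. g (k div e) (k mod e)) = (\<Sum>(u, v)\<in>{0..<b} \<times> {0..<e}. g u v)"
    by (rule sum.reindex_bij_witness[of _ "\<lambda>(u, v). u * e + v" "\<lambda>k. (k div e, k mod e)"])
       (auto simp: lt div_mod_less_product)
  then show ?thesis
    by (simp add: sum.cartesian_product)
qed

lemma kron_mult_kron:
  fixes A B C D :: "'a::comm_semiring_0 mat"
  assumes A: "A \<in> carrier_mat a b" and B: "B \<in> carrier_mat d e"
    and C: "C \<in> carrier_mat b c" and D: "D \<in> carrier_mat e f"
  shows "kron A B * kron C D = kron (A * C) (B * D)"
proof (rule eq_matI)
  fix i j assume "i < dim_row (kron (A * C) (B * D))" "j < dim_col (kron (A * C) (B * D))"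
  then have ij: "i < a * d" "j < c * f"
    using A B C D by (auto simp: kron_def)
  note dm = div_mod_less_product[OF ij(1)] div_mod_less_product[OF ij(2)]
  have "(kron A B * kron C D) $$ (i, j)
      = (\<Sum>k\<in>{0..<b * e}. A $$ (i div d, k div e) * B $$ (i mod d, k mod e)
           * (C $$ (k div e, j div f) * D $$ (k mod e, j mod f)))"
    using A B C D ij by (simp add: kron_def scalar_prod_def)
  also have "\<dots> = (\<Sum>u\<in>{0..<b}. \<Sum>v\<in>{0..<e}. A $$ (i div d, u) * B $$ (i mod d, v)
           * (C $$ (u, j div f) * D $$ (v, j mod f)))"
    by (rule sum_div_mod)
  also have "\<dots> = (\<Sum>u\<in>{0..<b}. A $$ (i div d, u) * C $$ (u, j div f))
           * (\<Sum>v\<in>{0..<e}. B $$ (i mod d, v) * D $$ (v, j mod f))"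
    by (simp add: sum_product mult_ac)
  also have "\<dots> = kron (A * C) (B * D) $$ (i, j)"
    using A B C D ij dm by (simp add: kron_def scalar_prod_def)
  finally show "(kron A B * kron C D) $$ (i, j) = kron (A * C) (B * D) $$ (i, j)" .
qed (use A B C D in \<open>auto simp: kron_def\<close>)

lemma transpose_kron: "transpose_mat (kron M N) = kron (transpose_mat M) (transpose_mat N)"
  by (rule eq_matI) (auto simp: kron_def div_mod_less_product)

lemma kron_one_one: "kron (1\<^sub>m a) (1\<^sub>m b) = (1\<^sub>m (a * b) :: 'a::semiring_1 mat)"
proof (rule eq_matI)
  fix i j assume "i < dim_row (1\<^sub>m (a * b) :: 'a mat)" "j < dim_col (1\<^sub>m (a * b) :: 'a mat)"
  then have ij: "i < a * b" "j < a * b"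
    by auto
  have "i = j \<longleftrightarrow> i div b = j div b \<and> i mod b = j mod b"
    by (metis div_mult_mod_eq)
  then show "kron (1\<^sub>m a) (1\<^sub>m b) $$ (i, j) = (1\<^sub>m (a * b) :: 'a mat) $$ (i, j)"
    using ij by (auto simp: kron_def div_mod_less_product)
qed (auto simp: kron_def)

lemma map_mat_kron:
  assumes "\<And>a b. h (a * b) = h a * h b"
  shows "map_mat h (kron M N) = kron (map_mat h M) (map_mat h N)"
  by (rule eq_matI) (auto simp: kron_def assms div_mod_less_product)

section \<open>Moments and localizing matrices\<close>

text \<open>
  Evaluation at \<open>x\<close> is the Riesz functional of the Dirac measure at \<open>x\<close>, so that linearity
  needs to be proved only for \<open>riesz\<close>.
\<close>

lemma eval_at_eq_riesz: "eval_at x = riesz (monomial_at x)"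
  by (simp add: fun_eq_iff eval_at_def riesz_def)

lemma riesz_add: "riesz y (p + q) = riesz y p + riesz y q"
  unfolding riesz_def
  by (rule setsum_keys_plus_distrib[where f = "\<lambda>\<alpha> c. c * y \<alpha>"]) (auto simp: algebra_simps)

lemma riesz_sum: "riesz y (\<Sum>i\<in>S. f i) = (\<Sum>i\<in>S. riesz y (f i))"
proof (induction S rule: infinite_finite_induct)
  case (insert i S)
  then show ?case by (simp add: riesz_add)
qed (simp_all add: riesz_def)

lemma riesz_single: "riesz y (Poly_Mapping.single \<alpha> c) = c * y \<alpha>"
  by (simp add: riesz_def)

lemma sum_single_lookup:
  "(\<Sum>\<alpha>\<in>Poly_Mapping.keys q. Poly_Mapping.single \<alpha> (Poly_Mapping.lookup q \<alpha>)) = q"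
proof (rule poly_mapping_eqI)
  fix \<beta>
  have "(\<Sum>\<alpha>\<in>Poly_Mapping.keys q. Poly_Mapping.lookup
          (Poly_Mapping.single \<alpha> (Poly_Mapping.lookup q \<alpha>)) \<beta>)
      = (\<Sum>\<alpha>\<in>Poly_Mapping.keys q. if \<alpha> = \<beta> then Poly_Mapping.lookup q \<alpha> else 0)"
    by (intro sum.cong) (auto simp: lookup_single when_def)
  also have "\<dots> = Poly_Mapping.lookup q \<beta>"
    by (auto simp: in_keys_iff)
  finally show "Poly_Mapping.lookup (\<Sum>\<alpha>\<in>Poly_Mapping.keys q.
      Poly_Mapping.single \<alpha> (Poly_Mapping.lookup q \<alpha>)) \<beta> = Poly_Mapping.lookup q \<beta>"
    by (simp add: lookup_sum)
qed

lemma monomial_at_add: "monomial_at x (\<alpha> + \<beta>) = monomial_at x \<alpha> * monomial_at x \<beta>"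
  by (simp add: monomial_at_def power_add prod.distrib)

lemma eval_at_mult: "eval_at x (p * q) = eval_at x p * eval_at x q"
proof -
  let ?c = "Poly_Mapping.lookup" and ?K = "Poly_Mapping.keys"
  have "p * q = (\<Sum>\<alpha>\<in>?K p. Poly_Mapping.single \<alpha> (?c p \<alpha>))
      * (\<Sum>\<beta>\<in>?K q. Poly_Mapping.single \<beta> (?c q \<beta>))"
    by (simp only: sum_single_lookup)
  also have "\<dots> = (\<Sum>\<alpha>\<in>?K p. \<Sum>\<beta>\<in>?K q. Poly_Mapping.single (\<alpha> + \<beta>) (?c p \<alpha> * ?c q \<beta>))"
    by (simp add: sum_product mult_single)
  finally have "eval_at x (p * q) = (\<Sum>\<alpha>\<in>?K p. \<Sum>\<beta>\<in>?K q.
      ?c p \<alpha> * ?c q \<beta> * monomial_at x (\<alpha> + \<beta>))"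
    by (simp add: eval_at_eq_riesz riesz_sum riesz_single)
  then show ?thesis
    by (simp add: eval_at_def sum_product monomial_at_add mult_ac)
qed

lemma representing_measureE:
  assumes "has_representing_measure y K"
  obtains \<mu> where "\<And>q. set_integrable \<mu> K (\<lambda>x. eval_at x q)"
    and "\<And>q. riesz y q = (LINT x:K|\<mu>. eval_at x q)"
proof -
  obtain \<mu> where mom: "\<And>\<alpha>. set_integrable \<mu> K (\<lambda>x. monomial_at x \<alpha>)"
      "\<And>\<alpha>. y \<alpha> = (LINT x:K|\<mu>. monomial_at x \<alpha>)"
    using assms unfolding has_representing_measure_def by blast
  have int: "integrable \<mu> (\<lambda>x. Poly_Mapping.lookup q \<alpha> * (indicator K x * monomial_at x \<alpha>))" for q \<alpha>
    using mom(1)[of \<alpha>] by (simp add: set_integrable_def)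
  \<comment> \<open>with the indicator inside, the set integrals become integrals of finite sums\<close>
  have expand: "indicator K x * eval_at x q = (\<Sum>\<alpha>\<in>Poly_Mapping.keys q.
      Poly_Mapping.lookup q \<alpha> * (indicator K x * monomial_at x \<alpha>))" for x q
    by (simp add: eval_at_def sum_distrib_left mult_ac)
  show thesis
  proof (rule that[of \<mu>])
    fix q
    show "set_integrable \<mu> K (\<lambda>x. eval_at x q)"
      unfolding set_integrable_def using int by (simp add: expand)
    show "riesz y q = (LINT x:K|\<mu>. eval_at x q)"
      unfolding set_lebesgue_integral_def using int
      by (simp add: expand riesz_def mom(2) set_lebesgue_integral_def)
  qed
qed

text \<open>
  Entry by entry, \<open>R * T = T\<close> is a linear relation with real coefficients between polynomial functions.
  Integrating it against the representing measure gives the same relation between the images of the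
  polynomials under the Riesz functional.
\<close>

lemma riesz_mult_invariant:
  assumes y: "has_representing_measure y K"
    and T: "T \<in> carrier_mat r c" and R: "R \<in> carrier_mat r r"
    and inv: "\<And>x. R * map_mat (eval_at x) T = map_mat (eval_at x) T"
  shows "R * map_mat (riesz y) T = map_mat (riesz y) T"
proof (rule eq_matI)
  obtain \<mu> where int: "\<And>q. set_integrable \<mu> K (\<lambda>x. eval_at x q)"
    and riesz: "\<And>q. riesz y q = (LINT x:K|\<mu>. eval_at x q)"
    using representing_measureE[OF y] by blast
  fix i j assume "i < dim_row (map_mat (riesz y) T)" "j < dim_col (map_mat (riesz y) T)"
  then have ij: "i < r" "j < c"
    using T by auto
  have pointwise: "(\<Sum>k\<in>{0..<r}. R $$ (i, k) * eval_at x (T $$ (k, j))) = eval_at x (T $$ (i, j))" for x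
    using arg_cong[OF inv[of x], of "\<lambda>M. M $$ (i, j)"] T R ij by (simp add: scalar_prod_def)
  have int': "integrable \<mu> (\<lambda>x. R $$ (i, k) * (indicator K x * eval_at x (T $$ (k, j))))" for k
    using int[of "T $$ (k, j)"] by (simp add: set_integrable_def)
  have "(R * map_mat (riesz y) T) $$ (i, j) = (\<Sum>k\<in>{0..<r}. R $$ (i, k) * riesz y (T $$ (k, j)))"
    using T R ij by (simp add: scalar_prod_def)
  also have "\<dots> = (\<integral>x. (\<Sum>k\<in>{0..<r}. R $$ (i, k) * (indicator K x * eval_at x (T $$ (k, j)))) \<partial>\<mu>)"
    using int' by (simp add: riesz set_lebesgue_integral_def)
  also have "(\<lambda>x. \<Sum>k\<in>{0..<r}. R $$ (i, k) * (indicator K x * eval_at x (T $$ (k, j))))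
      = (\<lambda>x. indicator K x * eval_at x (T $$ (i, j)))"
    by (simp add: pointwise[symmetric] sum_distrib_left mult_ac)
  also have "(\<integral>x. indicator K x * eval_at x (T $$ (i, j)) \<partial>\<mu>) = riesz y (T $$ (i, j))"
    by (simp add: riesz set_lebesgue_integral_def)
  finally show "(R * map_mat (riesz y) T) $$ (i, j) = map_mat (riesz y) T $$ (i, j)"
    using T ij by simp
qed (use T R in auto)

lemma monomial_row_gram_carrier:
  "transpose_mat (monomial_row ms) * monomial_row ms \<in> carrier_mat (length ms) (length ms)"
  by (auto simp: monomial_row_def)

lemma localizing_carrier:
  "M \<in> carrier_mat n m \<Longrightarrow> localizing ms y M \<in> carrier_mat (n * length ms) (m * length ms)"
  unfolding localizing_def using kron_carrier[OF _ monomial_row_gram_carrier] by simp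

lemma transpose_localizing:
  "transpose_mat (localizing ms y M) = localizing ms y (transpose_mat M)"
proof -
  let ?b = "monomial_row ms"
  have b: "?b \<in> carrier_mat 1 (length ms)"
    by (simp add: monomial_row_def)
  have "transpose_mat (transpose_mat ?b * ?b) = transpose_mat ?b * ?b"
    using transpose_mult[of "transpose_mat ?b" "length ms" 1 ?b "length ms"] b by simp
  moreover have "transpose_mat (map_mat f N) = map_mat f (transpose_mat N)" for f :: "'a mpoly \<Rightarrow> real" and N
    by (rule eq_matI) auto
  ultimately show ?thesis
    by (simp add: localizing_def transpose_kron)
qed

text \<open>
  At a point, the matrix under the Riesz functional is the Kronecker product of the value of \<open>M\<close> and
  \<open>b(x)\<^sup>T b(x)\<close>, because evaluation is multiplicative; the mixed product rule lets
  \<open>R\<close> act on the first factor alone.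
\<close>

lemma localizing_mult_invariant:
  assumes y: "has_representing_measure y K"
    and M: "M \<in> carrier_mat n m" and R: "R \<in> carrier_mat n n"
    and inv: "\<And>x. R * map_mat (eval_at x) M = map_mat (eval_at x) M"
  shows "kron R (1\<^sub>m (length ms)) * localizing ms y M = localizing ms y M"
  unfolding localizing_def
proof (rule riesz_mult_invariant[OF y])
  let ?W = "transpose_mat (monomial_row ms) * monomial_row ms"
  note W = monomial_row_gram_carrier[of ms]
  show "kron M ?W \<in> carrier_mat (n * length ms) (m * length ms)"
    using M W by (rule kron_carrier)
  show "kron R (1\<^sub>m (length ms)) \<in> carrier_mat (n * length ms) (n * length ms)"
    using R by (rule kron_carrier) simp
  fix x
  have "kron R (1\<^sub>m (length ms)) * kron (map_mat (eval_at x) M) (map_mat (eval_at x) ?W)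
      = kron (R * map_mat (eval_at x) M) (1\<^sub>m (length ms) * map_mat (eval_at x) ?W)"
    using M R W by (intro kron_mult_kron) auto
  also have "1\<^sub>m (length ms) * map_mat (eval_at x) ?W = map_mat (eval_at x) ?W"
    using W by (intro left_mult_one_mat) auto
  finally show "kron R (1\<^sub>m (length ms)) * map_mat (eval_at x) (kron M ?W)
      = map_mat (eval_at x) (kron M ?W)"
    by (simp only: map_mat_kron[OF eval_at_mult] inv)
qed

section \<open>Restriction to the column spaces of the projections\<close>

theorem proposition4:
  fixes p n m d :: nat
    and A B :: "nat \<Rightarrow> 'v::finite mpoly mat"
    and \<Gamma> G :: "'v mpoly mat"
    and K :: "(real ^ 'v) set"
    and s :: "nat \<Rightarrow> nat"
    and P Pim Chat :: "nat \<Rightarrow> real mat"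
    and Dhat :: "real mat"
    and y :: "nat ^ 'v \<Rightarrow> real"
    and ms :: "(nat ^ 'v) list"
    and ps :: "(nat \<times> nat) list"
    and I :: "nat \<Rightarrow> nat set"
    and nI L :: nat
    and Ahat Bhat Phat BDhat :: "nat \<Rightarrow> real mat"
    and \<Gamma>hat :: "real mat"
  defines "I \<equiv> \<lambda>k. row_support (A k)"
    and "nI \<equiv> overlap_total p I"
    and "L \<equiv> length ms"
    and "Ahat \<equiv> \<lambda>k. localizing ms y (A k)"
    and "Bhat \<equiv> \<lambda>k. localizing ms y (B k)"
    and "\<Gamma>hat \<equiv> localizing ms y \<Gamma>"
    and "Phat \<equiv> \<lambda>k. kron (P k) (1\<^sub>m L)"
    and "BDhat \<equiv> \<lambda>k. Bhat k + kron (Pim k) (1\<^sub>m L) * Dhat"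
  assumes p: "1 \<le> p"
    and arrow: "arrow_data p n m A B \<Gamma>"
    and G: "G = arrow_matrix p n m A B \<Gamma>"
    and K: "K = {x. psd (map_mat (eval_at x) G)}" "compact K"
    and A_psd: "\<And>x k. x \<in> K \<Longrightarrow> k \<in> {1..p} \<Longrightarrow> psd (map_mat (eval_at x) (A k))"
    and \<Gamma>_psd: "\<And>x. x \<in> K \<Longrightarrow> psd (map_mat (eval_at x) \<Gamma>)"
    and P: "\<And>k. k \<in> {1..p} \<Longrightarrow> s k \<le> n"
           "\<And>k. k \<in> {1..p} \<Longrightarrow> P k \<in> carrier_mat n (s k)"
           "\<And>k. k \<in> {1..p} \<Longrightarrow> vec_space.rank n (P k) = s k"
           "\<And>k. k \<in> {1..p} \<Longrightarrow> transpose_mat (P k) * P k = 1\<^sub>m (s k)"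
           "\<And>k x. k \<in> {1..p} \<Longrightarrow> Span (map_mat (eval_at x) (A k)) \<subseteq> Span (P k)"
    and y: "has_representing_measure y K"
    and ms: "enumerates_monomials d ms"
    and ps: "distinct ps" "set ps = pairs p"
    and Pim: "\<And>k. k \<in> {1..p} \<Longrightarrow> is_overlap_matrix p n m I ps k (Pim k)"
    and Dhat: "Dhat \<in> carrier_mat (L * nI) (L * m)"
    and Chat: "\<And>k. k \<in> {1..p-1} \<Longrightarrow> Chat k \<in> carrier_mat (m * L) (m * L)"
              "\<And>k. k \<in> {1..p-1} \<Longrightarrow> transpose_mat (Chat k) = Chat k"
    and Chat_p: "Chat p = \<Gamma>hat - msum (m * L) (m * L) Chat {1..p-1}"
  shows "(\<forall>k\<in>{1..p}.
            psd (four_block_mat (Ahat k) (BDhat k) (transpose_mat (BDhat k)) (Chat k)))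
     \<longleftrightarrow>
         (\<forall>k\<in>{1..p}.
            psd (four_block_mat
              (transpose_mat (Phat k) * Ahat k * Phat k) (transpose_mat (Phat k) * BDhat k)
              (transpose_mat (BDhat k) * Phat k)         (Chat k))) \<and>
         (\<forall>k\<in>{1..p}. Span (BDhat k) \<subseteq> Span (Phat k))"
proof -
  have block: "psd (four_block_mat (Ahat k) (BDhat k) (transpose_mat (BDhat k)) (Chat k)) \<longleftrightarrow>
      psd (four_block_mat
        (transpose_mat (Phat k) * Ahat k * Phat k) (transpose_mat (Phat k) * BDhat k)
        (transpose_mat (BDhat k) * Phat k) (Chat k)) \<and>
      Span (BDhat k) \<subseteq> Span (Phat k)"
    if k: "k \<in> {1..p}" for k
  proof (rule psd_block_compression)
    note Pk = P(2)[OF k] and orth = P(4)[OF k]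
    have A: "A k \<in> carrier_mat n n" "transpose_mat (A k) = A k" and B: "B k \<in> carrier_mat n m"
      using arrow k unfolding arrow_data_def by auto
    show "Ahat k \<in> carrier_mat (n * L) (n * L)"
      unfolding Ahat_def L_def by (rule localizing_carrier[OF A(1)])
    show "transpose_mat (Ahat k) = Ahat k"
      by (simp add: Ahat_def transpose_localizing A)
    have "Pim k \<in> carrier_mat n nI"
      using Pim[OF k] unfolding is_overlap_matrix_def nI_def by simp
    then have "kron (Pim k) (1\<^sub>m L) \<in> carrier_mat (n * L) (nI * L)"
      by (rule kron_carrier) simp
    then have "kron (Pim k) (1\<^sub>m L) * Dhat \<in> carrier_mat (n * L) (m * L)"
      using Dhat by (auto simp: mult.commute)
    moreover have "Bhat k \<in> carrier_mat (n * L) (m * L)"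
      unfolding Bhat_def L_def by (rule localizing_carrier[OF B])
    ultimately show "BDhat k \<in> carrier_mat (n * L) (m * L)"
      by (simp add: BDhat_def)
    have "Chat p \<in> carrier_mat (m * L) (m * L)"
      unfolding Chat_p msum_def by auto
    then show "Chat k \<in> carrier_mat (m * L) (m * L)"
      using Chat(1)[of k] k by (cases "k = p") auto
    show "Phat k \<in> carrier_mat (n * L) (s k * L)"
      unfolding Phat_def by (rule kron_carrier[OF Pk]) simp
    have PtP: "transpose_mat (Phat k) = kron (transpose_mat (P k)) (1\<^sub>m L)"
      by (simp add: Phat_def transpose_kron)
    show "transpose_mat (Phat k) * Phat k = 1\<^sub>m (s k * L)"
      unfolding PtP unfolding Phat_def
      using Pk orth by (simp add: kron_mult_kron[of _ "s k" n _ L L _ "s k" _ L] kron_one_one)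
    have "Phat k * transpose_mat (Phat k) = kron (P k * transpose_mat (P k)) (1\<^sub>m L)"
      unfolding PtP unfolding Phat_def
      using Pk by (simp add: kron_mult_kron[of _ n "s k" _ L L _ n _ L])
    moreover have "P k * transpose_mat (P k) * map_mat (eval_at x) (A k) = map_mat (eval_at x) (A k)" for x
      using P(5)[OF k, of x] A Pk orth by (subst (asm) Span_subset_iff_projection) auto
    ultimately show "Phat k * transpose_mat (Phat k) * Ahat k = Ahat k"
      unfolding Ahat_def L_def using Pk by (simp add: localizing_mult_invariant[OF y A(1), of _ ms])
  qed
  show ?thesis
    using block by blast
qed

end
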